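(* Let $R$ be a unital ring with involution $*$ and let $a,x\in R$. The following statements are equivalent: (i) $a$ is Moore-Penrose (MP) invertible and $x=a^\dagger$. (ii) $axa=a$, $xR=a^*R$ and $Rx=Ra^*$. (iii) $axa=a$, ${}^\circ x={}^\circ(a^* )$ and $x^\circ=(a^* )^\circ$. (iv) $axa=a$, $xR\subseteq a^*R$ and $Rx\subseteq Ra^*$. (v) $axa=a$, ${}^\circ(a^* )\subseteq{}^\circ x$ and $(a^* )^\circ\subseteq x^\circ$.
   Context: For $a\in R$: $aR=\{ax:x\in R\}$, $Ra=\{xa:x\in R\}$, $a^\circ=\{x\in R: ax=0\}$, ${}^\circ a=\{x\in R: xa=0\}$. The element $a$ is MP invertible if there is $y\in R$ with $aya=a$, $yay=y$, $(ay)^*=ay$, $(ya)^*=ya$; such $y$ is unique and is denoted $a^\dagger$. *)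

theory Defs
  imports Main
begin

text \<open>
  A unital ring is a type of sort \<open>{ring, monoid_mult}\<close>. Unlike \<open>ring_1\<close>, this sort does not
  require \<open>0 \<noteq> 1\<close>, so the zero ring is included. The involution is an explicit parameter, so that
  it is arbitrary even when the ring is fixed.
\<close>

locale ring_involution =
  fixes star :: "'a :: {ring, monoid_mult} \<Rightarrow> 'a"
  assumes star_star: "star (star a) = a"
    and star_add: "star (a + b) = star a + star b"
    and star_mult: "star (a * b) = star b * star a"

definition right_principal :: "'a :: {ring, monoid_mult} \<Rightarrow> 'a set"  \<comment> \<open>\<open>aR\<close>\<close>
  where "right_principal a = {a * x | x. True}"

definition left_principal :: "'a :: {ring, monoid_mult} \<Rightarrow> 'a set"  \<comment> \<open>\<open>Ra\<close>\<close>
  where "left_principal a = {x * a | x. True}"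

definition right_ann :: "'a :: {ring, monoid_mult} \<Rightarrow> 'a set"  \<comment> \<open>\<open>a\<close> with circle on the right\<close>
  where "right_ann a = {x. a * x = 0}"

definition left_ann :: "'a :: {ring, monoid_mult} \<Rightarrow> 'a set"  \<comment> \<open>\<open>a\<close> with circle on the left\<close>
  where "left_ann a = {x. x * a = 0}"

definition is_mp_inverse :: "('a :: {ring, monoid_mult} \<Rightarrow> 'a) \<Rightarrow> 'a \<Rightarrow> 'a \<Rightarrow> bool"
  where "is_mp_inverse star a y \<longleftrightarrow>
    a * y * a = a \<and> y * a * y = y \<and> star (a * y) = a * y \<and> star (y * a) = y * a"

definition mp_invertible :: "('a :: {ring, monoid_mult} \<Rightarrow> 'a) \<Rightarrow> 'a \<Rightarrow> bool"
  where "mp_invertible star a \<longleftrightarrow> (\<exists>y. is_mp_inverse star a y)"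

text \<open>Meaningful only if \<open>mp_invertible star a\<close>; see the lemma \<open>is_mp_inverse_mp_inverse\<close> below.\<close>

definition mp_inverse :: "('a :: {ring, monoid_mult} \<Rightarrow> 'a) \<Rightarrow> 'a \<Rightarrow> 'a"
  where "mp_inverse star a = (THE y. is_mp_inverse star a y)"

context ring_involution
begin

lemma is_mp_inverse_unique:
  assumes y: "is_mp_inverse star a y" and z: "is_mp_inverse star a z"
  shows "y = z"
proof -
  have "a * y = (a * z) * (a * y)"
    using z by (simp add: is_mp_inverse_def flip: mult.assoc)
  also have "\<dots> = star ((a * y) * (a * z))"
    using y z by (simp add: is_mp_inverse_def star_mult[of "a * y" "a * z"])
  also have "(a * y) * (a * z) = a * z"
    using y by (simp add: is_mp_inverse_def flip: mult.assoc)
  also have "star (a * z) = a * z"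
    using z by (simp add: is_mp_inverse_def)
  finally have ay: "a * y = a * z" .
  have "y * a = (y * a) * (z * a)"
    using z by (simp add: is_mp_inverse_def mult.assoc)
  also have "\<dots> = star ((z * a) * (y * a))"
    using y z by (simp add: is_mp_inverse_def star_mult[of "z * a" "y * a"])
  also have "(z * a) * (y * a) = z * a"
    using y by (simp add: is_mp_inverse_def mult.assoc)
  also have "star (z * a) = z * a"
    using z by (simp add: is_mp_inverse_def)
  finally have ya: "y * a = z * a" .
  have "y = y * a * y" using y by (simp add: is_mp_inverse_def)
  also have "\<dots> = z * (a * y)" by (simp add: ya mult.assoc)
  also have "\<dots> = z * a * z" by (simp add: ay mult.assoc)
  also have "\<dots> = z" using z by (simp add: is_mp_inverse_def)
  finally show ?thesis .
qed

lemma is_mp_inverse_mp_inverse: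
  assumes "mp_invertible star a"
  shows "is_mp_inverse star a (mp_inverse star a)"
  unfolding mp_inverse_def
  using assms is_mp_inverse_unique by (auto simp: mp_invertible_def intro: theI)

end

end

theory Submission
  imports Defs
begin

text \<open>
  Inclusions of principal one-sided ideals give reverse inclusions of annihilators, so it
  suffices that (i) implies (ii), which is read off from \<open>x = (xa)\<^sup>*x = x(ax)\<^sup>*\<close> and
  \<open>a\<^sup>* = xaa\<^sup>* = a\<^sup>*ax\<close>, and that (v) implies (i). For the latter, starring \<open>axa = a\<close> puts
  \<open>1 - a\<^sup>*x\<^sup>*\<close> in the left annihilator of \<open>a\<^sup>*\<close>, hence of \<open>x\<close>, so \<open>x = a\<^sup>*x\<^sup>*x\<close>. Then
  \<open>xa = (xa)\<^sup>*(xa)\<close> is self-adjoint, and \<open>x = (xa)\<^sup>*x = xax\<close>. The right annihilator gives in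
  the same way that \<open>ax\<close> is self-adjoint.
\<close>

text \<open>The unit puts \<open>x\<close> in its own right ideal, so \<open>x = b * u\<close> for
  some \<open>u\<close>, and whatever kills \<open>b\<close> from the left also kills
  \<open>x\<close>.\<close>

lemma left_ann_antimono:
  assumes "right_principal x \<subseteq> right_principal b"
  shows "left_ann b \<subseteq> left_ann x"
proof -
  have "x * 1 \<in> right_principal x"
    unfolding right_principal_def by blast
  then obtain u where "x = b * u"
    using assms by (auto simp: right_principal_def)
  then show ?thesis
    by (auto simp: left_ann_def simp flip: mult.assoc)
qed

lemma right_ann_antimono:
  assumes "left_principal x \<subseteq> left_principal b"
  shows "right_ann b \<subseteq> right_ann x"
proof -
  have "1 * x \<in> left_principal x"
    unfolding left_principal_def by blast
  then obtain u where "x = u * b"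
    using assms by (auto simp: left_principal_def)
  then show ?thesis
    by (auto simp: right_ann_def mult.assoc)
qed

lemma right_principal_mult_subset: "right_principal (a * b) \<subseteq> right_principal a"
  by (auto simp: right_principal_def mult.assoc)

lemma left_principal_mult_subset: "left_principal (a * b) \<subseteq> left_principal b"
  by (auto simp: left_principal_def simp flip: mult.assoc)

context ring_involution
begin

text \<open>Existence and uniqueness together eliminate the definite description, so that (i)
  becomes four equations.\<close>

lemma mp_inverse_eq_iff:
  "mp_invertible star a \<and> x = mp_inverse star a \<longleftrightarrow> is_mp_inverse star a x"
  using is_mp_inverse_mp_inverse is_mp_inverse_unique mp_invertible_def by blast

lemma right_principal_mp_inverse:
  assumes "is_mp_inverse star a x"
  shows "right_principal x = right_principal (star a)"
proof
  have "x = star (x * a) * x"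
    using assms by (simp add: is_mp_inverse_def)
  then have "x = star a * (star x * x)"
    by (simp add: star_mult mult.assoc)
  then show "right_principal x \<subseteq> right_principal (star a)"
    by (metis right_principal_mult_subset)
  \<comment> \<open>Bracketed this way, starring yields \<open>star (x * a)\<close> on the left,
    which equals \<open>x * a\<close> and so exposes the left factor \<open>x\<close>.\<close>
  have axa: "a * (x * a) = a"
    using assms by (simp add: is_mp_inverse_def mult.assoc)
  have "star a = star (x * a) * star a"
    by (simp add: axa flip: star_mult)
  also have "\<dots> = x * (a * star a)"
    using assms by (simp add: is_mp_inverse_def mult.assoc)
  finally show "right_principal (star a) \<subseteq> right_principal x"
    by (metis right_principal_mult_subset)
qed

lemma left_principal_mp_inverse:
  assumes "is_mp_inverse star a x"
  shows "left_principal x = left_principal (star a)"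
proof
  have "x = x * star (a * x)"
    using assms by (simp add: is_mp_inverse_def mult.assoc)
  then have "x = (x * star x) * star a"
    by (simp add: star_mult mult.assoc)
  then show "left_principal x \<subseteq> left_principal (star a)"
    by (metis left_principal_mult_subset)
  \<comment> \<open>The other bracketing: starring now leaves \<open>star (a * x) = a * x\<close> on
    the right, exposing the right factor \<open>x\<close>.\<close>
  have axa: "a * x * a = a"
    using assms by (simp add: is_mp_inverse_def)
  have "star a = star a * star (a * x)"
    by (simp add: axa flip: star_mult)
  also have "\<dots> = (star a * a) * x"
    using assms by (simp add: is_mp_inverse_def mult.assoc)
  finally show "left_principal (star a) \<subseteq> left_principal x"
    by (metis left_principal_mult_subset)
qed

lemma is_mp_inverse_if_ann_subset:
  assumes axa: "a * x * a = a"
    and left: "left_ann (star a) \<subseteq> left_ann x"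
    and right: "right_ann (star a) \<subseteq> right_ann x"
  shows "is_mp_inverse star a x"
proof -
  have star_axa: "star a * star x * star a = star a"
    using arg_cong[OF axa, of star] by (simp add: star_mult mult.assoc)
  have "1 - star a * star x \<in> left_ann (star a)"
    by (simp add: left_ann_def left_diff_distrib star_axa)
  then have "1 - star a * star x \<in> left_ann x"
    using left by blast
  then have x_left: "star (x * a) * x = x"
    by (simp add: left_ann_def left_diff_distrib star_mult)
  have "1 - star x * star a \<in> right_ann (star a)"
    using star_axa by (simp add: right_ann_def right_diff_distrib mult.assoc)
  then have "1 - star x * star a \<in> right_ann x"
    using right by blast
  then have x_right: "x * star (a * x) = x"
    by (simp add: right_ann_def right_diff_distrib star_mult)
  have "x * a = star (x * a) * (x * a)"
    by (simp add: x_left flip: mult.assoc)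
  \<comment> \<open>An element of the form \<open>star s * s\<close> is fixed by
    \<open>star\<close>.\<close>
  then have xa: "star (x * a) = x * a"
    by (metis star_mult star_star)
  have "a * x = (a * x) * star (a * x)"
    by (simp add: x_right mult.assoc)
  then have ax: "star (a * x) = a * x"
    by (metis star_mult star_star)
  show ?thesis
    \<comment> \<open>The remaining equation \<open>x * a * x = x\<close> is \<open>x_left\<close>
      rewritten with \<open>xa\<close>.\<close>
    using axa xa ax x_left by (simp add: is_mp_inverse_def)
qed

end

theorem theorem2p8:
  fixes star :: "'a :: {ring, monoid_mult} \<Rightarrow> 'a" and a x :: 'a
  assumes "ring_involution star"
  defines "i \<equiv> mp_invertible star a \<and> x = mp_inverse star a"
    and "ii \<equiv> a * x * a = a \<and> right_principal x = right_principal (star a)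
                \<and> left_principal x = left_principal (star a)"
    and "iii \<equiv> a * x * a = a \<and> left_ann x = left_ann (star a)
                \<and> right_ann x = right_ann (star a)"
    and "iv \<equiv> a * x * a = a \<and> right_principal x \<subseteq> right_principal (star a)
                \<and> left_principal x \<subseteq> left_principal (star a)"
    and "v \<equiv> a * x * a = a \<and> left_ann (star a) \<subseteq> left_ann x
                \<and> right_ann (star a) \<subseteq> right_ann x"
  shows "(i \<longleftrightarrow> ii) \<and> (i \<longleftrightarrow> iii) \<and> (i \<longleftrightarrow> iv) \<and> (i \<longleftrightarrow> v)"
proof -
  interpret ring_involution star by fact
  have i_iff: "i \<longleftrightarrow> is_mp_inverse star a x"
    unfolding i_def by (rule mp_inverse_eq_iff)
  \<comment> \<open>The implications form two cycles through (i), (ii) and (v): one passes through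
    (iii), the other through (iv).\<close>
  have "i \<Longrightarrow> ii"
    using right_principal_mp_inverse left_principal_mp_inverse
    by (simp add: i_iff ii_def is_mp_inverse_def)
  moreover have "ii \<Longrightarrow> iii"
    unfolding ii_def iii_def
    by (simp add: left_ann_antimono right_ann_antimono subset_antisym)
  moreover have "ii \<Longrightarrow> iv"
    by (simp add: ii_def iv_def)
  moreover have "iii \<Longrightarrow> v"
    by (simp add: iii_def v_def)
  moreover have "iv \<Longrightarrow> v"
    by (simp add: iv_def v_def left_ann_antimono right_ann_antimono)
  moreover have "v \<Longrightarrow> i"
    by (simp add: v_def i_iff is_mp_inverse_if_ann_subset)
  ultimately show ?thesis
    by blast
qed

end
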